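(* Let $t\in\{1,2,3\}$ and let $G$ be a simple connected $t$-tough graph of order $n$ and size $m$. If the spectral radius $\rho(G)$ of $G$ satisfies $$\rho(G) \geq \sqrt{n^2 - 4tn - 2n + 10t^2 + 2t + 1},$$ then $G$ is pancyclic or bipartite, provided that 1) $t=1$ and $n\ge 7$; or 2) $t=2$ and $n\ge 16$; or 3) $t=3$ and $n\ge 28$.
   Context: All graphs are finite, simple and undirected. The spectral radius $\rho(G)$ is the largest eigenvalue of the adjacency matrix $A(G)=(a_{ij})$, where $a_{ij}=1$ if $v_iv_j$ is an edge and $a_{ij}=0$ otherwise. For a graph $G$, $c(G)$ denotes the number of connected components. A vertex cutset of a connected graph $G$ is a set $S\subseteq V(G)$ with $c(G-S)\ge 2$, where $G-S$ is the subgraph induced by $V(G)\setminus S$. For a real number $t$, $G$ is $t$-tough if $t\cdot c(G-S)\le |S|$ for every vertex cutset $S$ of $G$ (complete graphs are $t$-tough for every $t$). A graph of order $n$ is pancyclic if it contains a cycle of every length $\ell$ with $3\le\ell\le n$. *)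

theory Defs
  imports
    "Graph_Theory.Graph_Theory"
    "Jordan_Normal_Form.Spectral_Radius"
begin

text \<open>
  A finite simple undirected graph is a \<open>graph\<close> in the sense of the session Graph_Theory:
  a finite, loop-free, symmetric digraph without parallel arcs, every undirected edge \<open>uv\<close>
  being represented by the two arcs \<open>u \<rightarrow> v\<close> and \<open>v \<rightarrow> u\<close>.
\<close>

definition edges :: "('a, 'b) pre_digraph \<Rightarrow> 'a set set" where
  "edges G = {{u, v} | u v. u \<rightarrow>\<^bsub>G\<^esub> v}"

subsection \<open>Spectral radius\<close>

definition vertex_labelling :: "('a, 'b) pre_digraph \<Rightarrow> 'a list \<Rightarrow> bool" where
  "vertex_labelling G vs \<longleftrightarrow> distinct vs \<and> set vs = verts G"

definition adj_matrix :: "('a, 'b) pre_digraph \<Rightarrow> 'a list \<Rightarrow> real mat" where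
  "adj_matrix G vs =
     mat (length vs) (length vs) (\<lambda>(i, j). if (vs ! i) \<rightarrow>\<^bsub>G\<^esub> (vs ! j) then 1 else 0)"

text \<open>
  The spectrum does not depend on the labelling of the vertices, see
  \<open>spectrum_adj_matrix_cong\<close> below. The adjacency matrix being real symmetric, its real
  eigenvalues are all its eigenvalues.
\<close>

definition graph_spectral_radius :: "('a, 'b) pre_digraph \<Rightarrow> real" where
  "graph_spectral_radius G = Max (spectrum (adj_matrix G (SOME vs. vertex_labelling G vs)))"

lemma eigenvalue_adj_matrix_iff:
  assumes "vertex_labelling G vs"
  shows "eigenvalue (adj_matrix G vs) k \<longleftrightarrow>
    (\<exists>f. (\<exists>v\<in>verts G. f v \<noteq> 0) \<and>
         (\<forall>v\<in>verts G. (\<Sum>w\<in>verts G. if v \<rightarrow>\<^bsub>G\<^esub> w then f w else 0) = k * f v))"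
    (is "?L \<longleftrightarrow> ?R")
proof -
  let ?n = "length vs"
  have V: "verts G = (!) vs ` {..<?n}" and inj: "inj_on ((!) vs) {..<?n}"
    using assms by (auto simp: vertex_labelling_def set_conv_nth inj_on_def nth_eq_iff_index_eq)
  have sum_V: "(\<Sum>w\<in>verts G. h w) = (\<Sum>j<?n. h (vs ! j))" for h :: "'a \<Rightarrow> real"
    unfolding V using inj by (simp add: sum.reindex)
  have mult: "(adj_matrix G vs *\<^sub>v x) $ i = (\<Sum>j<?n. if (vs ! i) \<rightarrow>\<^bsub>G\<^esub> (vs ! j) then x $ j else 0)"
    if "x \<in> carrier_vec ?n" "i < ?n" for x i
    using that unfolding adj_matrix_def
    by (auto simp: scalar_prod_def lessThan_atLeast0 intro!: sum.cong)
  have dim: "dim_row (adj_matrix G vs) = ?n"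
    by (simp add: adj_matrix_def)
  show ?thesis
  proof
    assume ?L
    then obtain x where x: "x \<in> carrier_vec ?n" "x \<noteq> 0\<^sub>v ?n" "adj_matrix G vs *\<^sub>v x = k \<cdot>\<^sub>v x"
      by (auto simp: eigenvalue_def eigenvector_def dim)
    define f where "f v = x $ (the_inv_into {..<?n} ((!) vs) v)" for v
    have f: "f (vs ! i) = x $ i" if "i < ?n" for i
      using that inj by (simp add: f_def the_inv_into_f_f)
    from x(1,2) obtain i where "i < ?n" "x $ i \<noteq> 0"
      by (auto simp: vec_eq_iff)
    then have "\<exists>v\<in>verts G. f v \<noteq> 0"
      using f by (auto simp: V)
    moreover have "(\<Sum>j<?n. if (vs ! i) \<rightarrow>\<^bsub>G\<^esub> (vs ! j) then f (vs ! j) else 0) = k * f (vs ! i)"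
      if "i < ?n" for i
    proof -
      have "(\<Sum>j<?n. if (vs ! i) \<rightarrow>\<^bsub>G\<^esub> (vs ! j) then f (vs ! j) else 0)
          = (\<Sum>j<?n. if (vs ! i) \<rightarrow>\<^bsub>G\<^esub> (vs ! j) then x $ j else 0)"
        by (rule sum.cong) (auto simp: f)
      also have "\<dots> = (k \<cdot>\<^sub>v x) $ i"
        using mult[OF x(1) that] x(3) by simp
      finally show ?thesis
        using that x(1) f by simp
    qed
    ultimately show ?R
      by (intro exI[of _ f]) (auto simp: sum_V, auto simp: V)
  next
    assume ?R
    then obtain f where f: "\<exists>v\<in>verts G. f v \<noteq> 0"
      "\<forall>v\<in>verts G. (\<Sum>w\<in>verts G. if v \<rightarrow>\<^bsub>G\<^esub> w then f w else 0) = k * f v"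
      by blast
    define x where "x = vec ?n (\<lambda>i. f (vs ! i))"
    have x: "x \<in> carrier_vec ?n"
      by (simp add: x_def)
    have "x \<noteq> 0\<^sub>v ?n"
      using f(1) by (auto simp: V x_def vec_eq_iff)
    moreover have "adj_matrix G vs *\<^sub>v x = k \<cdot>\<^sub>v x"
    proof (rule eq_vecI)
      fix i assume "i < dim_vec (k \<cdot>\<^sub>v x)"
      then have i: "i < ?n" by (simp add: x_def)
      have "(adj_matrix G vs *\<^sub>v x) $ i
          = (\<Sum>j<?n. if (vs ! i) \<rightarrow>\<^bsub>G\<^esub> (vs ! j) then f (vs ! j) else 0)"
        unfolding mult[OF x i] by (rule sum.cong) (auto simp: x_def)
      also have "\<dots> = k * f (vs ! i)"
        using f(2)[unfolded sum_V] i by (auto simp: V)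
      finally show "(adj_matrix G vs *\<^sub>v x) $ i = (k \<cdot>\<^sub>v x) $ i"
        using i by (simp add: x_def)
    qed (simp add: x_def adj_matrix_def)
    ultimately show ?L
      using x by (auto simp: eigenvalue_def eigenvector_def dim)
  qed
qed

lemma spectrum_adj_matrix_cong:
  assumes "vertex_labelling G vs" "vertex_labelling G ws"
  shows "spectrum (adj_matrix G vs) = spectrum (adj_matrix G ws)"
  unfolding spectrum_def
  by (rule Collect_cong)
    (simp only: eigenvalue_adj_matrix_iff[OF assms(1)] eigenvalue_adj_matrix_iff[OF assms(2)])

subsection \<open>Toughness\<close>

text \<open>
  In a symmetric digraph the strongly connected components are the connected components of
  the undirected graph. They are nonempty, so the null graph has none.
\<close>

definition num_components :: "('a, 'b) pre_digraph \<Rightarrow> nat" where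
  "num_components G = card (pre_digraph.sccs G)"

definition delete_verts :: "('a, 'b) pre_digraph \<Rightarrow> 'a set \<Rightarrow> ('a, 'b) pre_digraph" where
  "delete_verts G S = G \<restriction> (verts G - S)"

definition vertex_cutset :: "('a, 'b) pre_digraph \<Rightarrow> 'a set \<Rightarrow> bool" where
  "vertex_cutset G S \<longleftrightarrow> S \<subseteq> verts G \<and> num_components (delete_verts G S) \<ge> 2"

text \<open>Complete graphs have no vertex cutset and hence are \<open>t\<close>-tough for every \<open>t\<close>.\<close>

definition tough :: "real \<Rightarrow> ('a, 'b) pre_digraph \<Rightarrow> bool" where
  "tough t G \<longleftrightarrow>
     (\<forall>S. vertex_cutset G S \<longrightarrow> t * real (num_components (delete_verts G S)) \<le> real (card S))"

subsection \<open>Cycles\<close>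

text \<open>
  The library's \<open>cycle\<close> is a directed one and also admits \<open>u \<rightarrow> v \<rightarrow> u\<close>. In a symmetric
  digraph, the directed cycles of length at least 3 are precisely the (oriented) cycles of the
  undirected graph.
\<close>

definition pancyclic :: "('a, 'b) pre_digraph \<Rightarrow> bool" where
  "pancyclic G \<longleftrightarrow> (\<forall>l. 3 \<le> l \<and> l \<le> card (verts G) \<longrightarrow> (\<exists>p. pre_digraph.cycle G p \<and> length p = l))"

definition bipartite :: "('a, 'b) pre_digraph \<Rightarrow> bool" where
  "bipartite G \<longleftrightarrow>
     (\<exists>X Y. verts G = X \<union> Y \<and> X \<inter> Y = {} \<and>
        (\<forall>u v. u \<rightarrow>\<^bsub>G\<^esub> v \<longrightarrow> u \<in> X \<and> v \<in> Y \<or> u \<in> Y \<and> v \<in> X))"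

end

theory Submission
  imports Defs
begin

text \<open>
  A \<open>t\<close>-tough graph on more than \<open>2t\<close> vertices has minimum degree at least \<open>2t\<close>, so the column sums of
  \<open>A\<^sup>2 - (2t - 1) A\<close> are at most \<open>2m - 2t(n - 1)\<close>, whence
  \<open>\<rho>\<^sup>2 - (2t - 1) \<rho> \<le> 2m - 2t(n - 1)\<close>. The hypothesis on \<open>\<rho>\<close> therefore forces \<open>m\<close> to be so large
  that, by Bondy's theorem, \<open>G\<close> is pancyclic as soon as it is Hamiltonian. If it were not, an
  edge-maximal non-Hamiltonian supergraph \<open>H\<close> on the same vertices would satisfy
  \<open>deg x + deg y \<le> n - 1\<close> for nonadjacent \<open>x\<close>, \<open>y\<close>. Chvatal's degree count for \<open>H\<close>, sharpened by
  toughness, contradicts the lower bound on \<open>m\<close> except for \<open>(t, n) = (2, 17)\<close> and \<open>(3, 29)\<close>, where \<open>H\<close>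
  may have \<open>(n + 1) / 2\<close> vertices of degree at most \<open>(n - 1) / 2\<close>. There the column sums of
  \<open>A(H)\<^sup>2 - ((n - 3) / 2) A(H)\<close> bound \<open>\<rho>\<close> directly.
\<close>

section \<open>Cycles in simple graphs\<close>

definition nbs :: "('a \<Rightarrow> 'a \<Rightarrow> bool) \<Rightarrow> 'a \<Rightarrow> 'a set" where
  "nbs E x = {y. E x y}"

definition deg :: "('a \<Rightarrow> 'a \<Rightarrow> bool) \<Rightarrow> 'a \<Rightarrow> nat" where
  "deg E x = card (nbs E x)"

definition cyclic :: "('a \<Rightarrow> 'a \<Rightarrow> bool) \<Rightarrow> 'a list \<Rightarrow> bool" where
  "cyclic E xs \<longleftrightarrow> distinct xs \<and> 3 \<le> length xs \<and> successively E xs \<and> E (last xs) (hd xs)"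

definition hamiltonian :: "'a set \<Rightarrow> ('a \<Rightarrow> 'a \<Rightarrow> bool) \<Rightarrow> bool" where
  "hamiltonian V E \<longleftrightarrow> (\<exists>xs. cyclic E xs \<and> set xs = V)"

text \<open>Adjacency is a bare relation, so that edges can be added and supergraphs compared
  without introducing arcs.\<close>

locale simple_graph =
  fixes V :: "'a set" and E :: "'a \<Rightarrow> 'a \<Rightarrow> bool"
  assumes finite_V: "finite V"
    and E_in: "E x y \<Longrightarrow> x \<in> V \<and> y \<in> V"
    and E_sym: "E x y \<Longrightarrow> E y x"
    and E_irrefl: "\<not> E x x"
begin

lemma E_commute: "E x y = E y x"
  using E_sym by blast

lemma nbs_subset: "nbs E x \<subseteq> V"
  using E_in by (auto simp: nbs_def)

lemma finite_nbs [simp]: "finite (nbs E x)"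
  using nbs_subset finite_V finite_subset by blast

lemma path_rev: "successively E xs \<Longrightarrow> successively E (rev xs)"
  by (simp add: E_commute[symmetric] successively_rev)

text \<open>The path is followed up to index \<open>j\<close>, left by the chord to its last vertex,
  traversed backwards to index \<open>k\<close> and closed by the chord to its head. Only the
  vertices strictly between \<open>j\<close> and \<open>k\<close> are skipped.\<close>

lemma cyclic_crossing:
  assumes p: "distinct xs" "successively E xs"
    and jk: "j < k" "k < length xs" "3 \<le> j + 1 + (length xs - k)"
    and c: "E (last xs) (xs ! j)" "E (hd xs) (xs ! k)"
  shows "cyclic E (take (Suc j) xs @ rev (drop k xs))"
    "length (take (Suc j) xs @ rev (drop k xs)) = j + 1 + (length xs - k)"
proof -
  let ?a = "take (Suc j) xs" and ?b = "drop k xs"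
  have ne: "xs \<noteq> []" "?a \<noteq> []" "?b \<noteq> []" using jk by auto
  have "successively E ?a" "successively E ?b"
    using p(2) append_take_drop_id[of "Suc j" xs] append_take_drop_id[of k xs]
    by (metis successively_append_iff)+
  moreover have la: "last ?a = xs ! j" using jk by (simp add: take_Suc_conv_app_nth)
  moreover have "last ?b = last xs" using jk by simp
  moreover have "hd ?a = hd xs" using ne by (cases xs) auto
  moreover have "hd ?b = xs ! k" using jk by (simp add: hd_drop_conv_nth)
  moreover have "set ?a \<inter> set ?b = {}"
    using p(1) jk by (intro set_take_disj_set_drop_if_distinct) auto
  ultimately show "cyclic E (?a @ rev ?b)"
    using ne p c jk path_rev[of ?b] E_sym
    by (auto simp: cyclic_def successively_append_iff hd_rev last_rev)
  show "length (?a @ rev ?b) = j + 1 + (length xs - k)" using jk by auto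
qed

lemma deg_eq_card_indices:
  assumes "distinct xs" "set xs = V"
  shows "deg E x = card {k. k < length xs \<and> E x (xs ! k)}"
proof -
  have "bij_betw ((!) xs) {k. k < length xs \<and> E x (xs ! k)} (nbs E x)"
    unfolding bij_betw_def using assms E_in
    by (auto simp: inj_on_def nth_eq_iff_index_eq nbs_def in_set_conv_nth image_iff) 
      (metis in_set_conv_nth)
  then show ?thesis by (simp add: deg_def bij_betw_same_card)
qed

text \<open>Ore's crossing argument: a chord from the last vertex to \<open>xs ! j\<close> and one
  from the head to \<open>xs ! Suc j\<close> would close the path to a Hamiltonian cycle. So
  \<open>A\<close> and the shift of \<open>B\<close> are disjoint.\<close>

lemma hamiltonian_path_deg_sum:
  assumes xs: "distinct xs" "set xs = V" "successively E xs" "3 \<le> length xs"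
    and nh: "\<not> hamiltonian V E"
  shows "deg E (hd xs) + deg E (last xs) \<le> card V - 1"
proof -
  let ?n = "length xs"
  have n: "?n = card V" using xs distinct_card by fastforce
  have ne: "xs \<noteq> []" using xs(4) by auto
  define A where "A = {k. k < ?n \<and> E (hd xs) (xs ! k)}"
  define B where "B = {k. k < ?n \<and> E (last xs) (xs ! k)}"
  have A0: "0 \<notin> A" using ne E_irrefl by (auto simp: A_def hd_conv_nth)
  have Bn: "?n - 1 \<notin> B" using ne E_irrefl by (auto simp: B_def last_conv_nth)
  have disj: "A \<inter> Suc ` B = {}"
  proof (rule ccontr)
    assume "A \<inter> Suc ` B \<noteq> {}"
    then obtain j where j: "j \<in> B" "Suc j \<in> A" by blast
    from cyclic_crossing[OF xs(1,3), of j "Suc j"] j xs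
    have c: "cyclic E (take (Suc j) xs @ rev (drop (Suc j) xs))" by (auto simp: A_def B_def)
    moreover have "set (take (Suc j) xs @ rev (drop (Suc j) xs)) = V"
      using xs(2) by (metis append_take_drop_id set_append set_rev)
    ultimately show False using nh by (auto simp: hamiltonian_def)
  qed
  have "A \<union> Suc ` B \<subseteq> {1..<?n}"
  proof
    fix m assume "m \<in> A \<union> Suc ` B"
    then show "m \<in> {1..<?n}"
    proof
      assume "m \<in> A" then show ?thesis using A0 by (cases m) (auto simp: A_def)
    next
      assume "m \<in> Suc ` B"
      then obtain b where "b \<in> B" "m = Suc b" by blast
      moreover from this Bn have "b \<noteq> ?n - 1" by auto
      ultimately show ?thesis by (auto simp: B_def)
    qed
  qed
  then have "card (A \<union> Suc ` B) \<le> ?n - 1"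
    by (metis card_atLeastLessThan card_mono finite_atLeastLessThan)
  moreover have "card (A \<union> Suc ` B) = card A + card B"
    using disj by (subst card_Un_disjoint) (auto simp: A_def B_def card_image)
  ultimately show ?thesis
    using deg_eq_card_indices[OF xs(1,2)] n by (simp add: A_def B_def)
qed

text \<open>
  Chords from \<open>hd xs\<close> to \<open>xs ! k\<close> and from \<open>last xs\<close> to \<open>xs ! f k\<close>, with \<open>f\<close> the cyclic shift by
  \<open>l - 3\<close> of the inner indices, close up to a cycle of length \<open>l\<close>.
\<close>

lemma cyclic_of_heavy_edge:
  assumes xs: "distinct xs" "set xs = V" "successively E xs" "E (last xs) (hd xs)"
    and l: "3 \<le> l" "l \<le> length xs"
    and heavy: "deg E (hd xs) + deg E (last xs) > card V"
  shows "\<exists>ys. cyclic E ys \<and> length ys = l"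
proof (rule ccontr)
  assume no: "\<not> ?thesis"
  let ?n = "length xs"
  have n: "?n = card V" using xs distinct_card by fastforce
  have ne: "xs \<noteq> []" and n3: "3 \<le> ?n" using l by auto
  define A where "A = {k. k < ?n \<and> E (hd xs) (xs ! k)}"
  define B where "B = {k. k < ?n \<and> E (last xs) (xs ! k)}"
  define f where "f k = (if k + l \<le> ?n + 1 then k + l - 3 else k + l - ?n - 1)" for k
  let ?I = "{1..<?n - 1}"
  have A0: "0 \<notin> A" using ne E_irrefl by (auto simp: A_def hd_conv_nth)
  have Bn: "?n - 1 \<notin> B" using ne E_irrefl by (auto simp: B_def last_conv_nth)
  have injf: "inj_on f ?I" using l by (auto simp: inj_on_def f_def split: if_splits)
  have fI: "f ` ?I \<subseteq> ?I" using l by (auto simp: f_def)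
  have disj: "f ` (A \<inter> ?I) \<inter> B = {}"
  proof (rule ccontr)
    assume "f ` (A \<inter> ?I) \<inter> B \<noteq> {}"
    then obtain k where k: "k \<in> A" "k \<in> ?I" "f k \<in> B" by blast
    show False
    proof (cases "k + l \<le> ?n + 1")
      case True
      let ?k = "k + l - 3"
      let ?s = "take (l - 2) (drop k xs)"
      \<comment> \<open>No wrap-around: jump from the head to \<open>xs ! k\<close>, follow
        \<open>l - 2\<close> path vertices, jump to the last vertex and return by the closing
        edge.\<close>
      let ?ys = "hd xs # ?s @ [last xs]"
      have ls: "length ?s = l - 2" using True l k by auto
      have sne: "?s \<noteq> []" using ls l by auto
      have "successively E ?s"
        using xs(3) append_take_drop_id[of k xs] append_take_drop_id[of "l-2" "drop k xs"]
        by (metis successively_append_iff)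
      moreover have "hd ?s = xs ! k" using sne k by (simp add: hd_drop_conv_nth)
      moreover have "last ?s = xs ! f k"
      proof -
        have "last ?s = drop k xs ! (l - 3)"
          using sne ls l by (simp add: last_conv_nth del: length_take length_drop)
        also have "\<dots> = xs ! (k + (l - 3))" using True l k by (intro nth_drop) auto
        finally show ?thesis using l True by (simp add: f_def)
      qed
      moreover have "distinct ?ys"
      proof -
        have "set ?s = (!) xs ` {k..<k+l-2}"
        proof -
          have "set ?s = (\<lambda>i. ?s ! i) ` {..<l-2}" using ls by (metis list.set_map map_nth set_upt atLeast0LessThan)
          also have "\<dots> = (\<lambda>i. xs ! (k + i)) ` {..<l-2}" using True l by (intro image_cong) auto
          also have "\<dots> = (!) xs ` ((+) k ` {..<l-2})" by (simp add: image_image)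
          also have "(+) k ` {..<l-2} = {k..<k+l-2}"
            using l by (simp add: lessThan_atLeast0 image_add_atLeastLessThan add.commute)
          finally show ?thesis .
        qed
        then show ?thesis
          using xs(1) k True ne l
          by (auto simp: hd_conv_nth last_conv_nth nth_eq_iff_index_eq)
      qed
      ultimately have "cyclic E ?ys"
        using sne k xs(4) l E_sym ls
        by (auto simp: cyclic_def A_def B_def successively_append_iff successively_Cons)
      moreover have "length ?ys = l" using ls l by simp
      ultimately show False using no by blast
    next
      case False
      then have fk: "f k = k + l - ?n - 1" by (simp add: f_def)
      \<comment> \<open>The shift wraps, so the crossing construction applies and skips exactly
        \<open>?n - l\<close> vertices.\<close>
      have jk: "f k < k" "k < ?n" "f k + 1 + (?n - k) = l" using k fk False l by auto
      moreover have "E (last xs) (xs ! f k)" "E (hd xs) (xs ! k)"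
        using k by (auto simp: A_def B_def)
      ultimately show False
        using no cyclic_crossing[OF xs(1,3), of "f k" k] l(1) by metis
    qed
  qed
  have fin: "finite A" "finite B" by (auto simp: A_def B_def)
  have "card (f ` (A \<inter> ?I) \<union> (B \<inter> ?I)) \<le> card ?I"
    using fI by (intro card_mono) auto
  moreover have "card (f ` (A \<inter> ?I) \<union> (B \<inter> ?I)) = card (A \<inter> ?I) + card (B \<inter> ?I)"
    using disj injf fin by (subst card_Un_disjoint) (auto simp: card_image inj_on_Int)
  \<comment> \<open>Outside \<open>?I\<close>, the only possible index in \<open>A\<close> is
    \<open>?n - 1\<close>, and in \<open>B\<close> it is \<open>0\<close>. So the total is at most
    \<open>(?n - 2) + 2\<close>.\<close>
  moreover have "card A \<le> card (A \<inter> ?I) + 1"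
  proof -
    have "A \<subseteq> insert (?n - 1) (A \<inter> ?I)"
    proof
      fix m assume "m \<in> A"
      then show "m \<in> insert (?n - 1) (A \<inter> ?I)" using A0 by (cases m) (auto simp: A_def)
    qed
    then have "card A \<le> card (insert (?n - 1) (A \<inter> ?I))" using fin by (intro card_mono) auto
    also have "\<dots> \<le> card (A \<inter> ?I) + 1" using fin by (simp add: card_insert_if)
    finally show ?thesis .
  qed
  moreover have "card B \<le> card (B \<inter> ?I) + 1"
  proof -
    have "B \<subseteq> insert 0 (B \<inter> ?I)"
    proof
      fix m assume m: "m \<in> B"
      then have "m \<noteq> ?n - 1" using Bn by auto
      then show "m \<in> insert 0 (B \<inter> ?I)" using m by (cases m) (auto simp: B_def)
    qed
    then have "card B \<le> card (insert 0 (B \<inter> ?I))" using fin by (intro card_mono) auto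
    also have "\<dots> \<le> card (B \<inter> ?I) + 1" using fin by (simp add: card_insert_if)
    finally show ?thesis .
  qed
  ultimately have "card A + card B \<le> ?n" using n3 by auto
  then show False
    using heavy deg_eq_card_indices[OF xs(1,2)] n by (simp add: A_def B_def)
qed

section \<open>Bondy's theorem\<close>

lemma cyclic_rotate1:
  assumes "cyclic E xs" shows "cyclic E (rotate1 xs)"
  using assms by (cases xs) (auto simp: cyclic_def successively_append_iff successively_Cons split: if_splits)

lemma cyclic_rotate:
  "cyclic E xs \<Longrightarrow> cyclic E (rotate k xs)"
  by (induction k) (auto intro: cyclic_rotate1)

text \<open>Each vertex lies on two edges of the Hamiltonian cycle. By averaging, some edge of it
  has degree sum above \<open>card V\<close>, and rotating the cycle makes this the closing
  edge.\<close>

lemma bondy: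
  assumes "hamiltonian V E" and dense: "(card V)\<^sup>2 < 2 * (\<Sum>v\<in>V. deg E v)"
    and l: "3 \<le> l" "l \<le> card V"
  shows "\<exists>ys. cyclic E ys \<and> length ys = l"
proof (rule ccontr)
  assume no: "\<not> ?thesis"
  obtain xs where xs: "cyclic E xs" "set xs = V" using assms(1) by (auto simp: hamiltonian_def)
  let ?n = "length xs"
  have d: "distinct xs" and n: "?n = card V" and n3: "3 \<le> ?n"
    using xs distinct_card by (fastforce simp: cyclic_def)+
  have le: "deg E (xs ! k) + deg E (xs ! ((k + ?n - 1) mod ?n)) \<le> ?n" if "k < ?n" for k
  proof -
    let ?ys = "rotate k xs"
    have "cyclic E ?ys" using xs(1) by (rule cyclic_rotate)
    moreover have "hd ?ys = xs ! k" using that n3 by (subst hd_rotate_conv_nth) auto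
    moreover have "last ?ys = xs ! ((k + ?n - 1) mod ?n)"
      using n3 by (subst last_conv_nth) (auto simp: nth_rotate)
    ultimately show ?thesis
      using cyclic_of_heavy_edge[of ?ys l] no xs(2) l n by (force simp: cyclic_def)
  qed
  have s: "(\<Sum>v\<in>V. deg E v) = (\<Sum>k<?n. deg E (xs ! k))"
    using sum.reindex_bij_betw[OF bij_betw_nth[OF d refl refl], of "deg E"] xs(2) by simp
  have bij: "bij_betw (\<lambda>k. (k + ?n - 1) mod ?n) {..<?n} {..<?n}"
  proof -
    have "inj_on (\<lambda>k. (k + ?n - 1) mod ?n) {..<?n}"
    proof (rule inj_onI)
      fix a b assume ab: "a \<in> {..<?n}" "b \<in> {..<?n}" "(a + ?n - 1) mod ?n = (b + ?n - 1) mod ?n"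
      have "(a + ?n - 1) mod ?n = (if a = 0 then ?n - 1 else a - 1)" if "a < ?n" for a
        using that n3 by (cases a) auto
      then show "a = b" using ab n3 by (auto split: if_splits)
    qed
    moreover have "(\<lambda>k. (k + ?n - 1) mod ?n) ` {..<?n} \<subseteq> {..<?n}"
      using n3 by (auto simp: Suc_le_eq intro!: mod_less_divisor)
    ultimately show ?thesis by (simp add: bij_betw_def endo_inj_surj)
  qed
  have "2 * (\<Sum>v\<in>V. deg E v) = (\<Sum>k<?n. deg E (xs ! k) + deg E (xs ! ((k + ?n - 1) mod ?n)))"
    using sum.reindex_bij_betw[OF bij, of "\<lambda>k. deg E (xs ! k)"] s by (simp add: sum.distrib)
  also have "\<dots> \<le> (\<Sum>k<?n. ?n)" using le by (intro sum_mono) auto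
  also have "\<dots> = (card V)\<^sup>2" using n by (simp add: power2_eq_square)
  finally show False using dense by simp
qed

end

section \<open>Degree sums and toughness\<close>

text \<open>
  A labelling that is constant along the edges outside \<open>S\<close> has at most as many values there as
  there are components; counting labels avoids handling components.
\<close>

definition tough_rel :: "'a set \<Rightarrow> ('a \<Rightarrow> 'a \<Rightarrow> bool) \<Rightarrow> nat \<Rightarrow> bool" where
  "tough_rel V E t \<longleftrightarrow> (\<forall>S f. S \<subseteq> V \<longrightarrow> (\<forall>x\<in>V - S. \<forall>y\<in>V - S. E x y \<longrightarrow> f x = (f y :: 'a)) \<longrightarrow>
     2 \<le> card (f ` (V - S)) \<longrightarrow> t * card (f ` (V - S)) \<le> card S)"

lemma tough_relD:
  fixes f :: "'a \<Rightarrow> 'a"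
  assumes "tough_rel V E t" "S \<subseteq> V"
    "\<And>x y. x \<in> V - S \<Longrightarrow> y \<in> V - S \<Longrightarrow> E x y \<Longrightarrow> f x = f y"
    "2 \<le> card (f ` (V - S))"
  shows "t * card (f ` (V - S)) \<le> card S"
  using assms(1)[unfolded tough_rel_def, rule_format, of S f] assms(2-4) by blast

lemma tough_rel_mono:
  assumes "tough_rel V E t" "\<And>x y. E x y \<Longrightarrow> H x y"
  shows "tough_rel V H t"
  using assms unfolding tough_rel_def by meson

context simple_graph
begin

lemma deg_le: "x \<in> V \<Longrightarrow> deg E x \<le> card V - 1"
proof -
  assume "x \<in> V"
  have "nbs E x \<subseteq> V - {x}" using nbs_subset E_irrefl by (auto simp: nbs_def)
  then have "deg E x \<le> card (V - {x})" unfolding deg_def using finite_V by (intro card_mono) auto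
  then show ?thesis using \<open>x \<in> V\<close> by simp
qed

text \<open>If \<open>x\<close> has a nonneighbour, deleting \<open>nbs E x\<close> separates the
  two, and two labels suffice. Otherwise \<open>x\<close> is adjacent to all other vertices.\<close>

lemma tough_rel_min_deg:
  assumes t: "tough_rel V E t" and n: "2 * t < card V" and x: "x \<in> V"
  shows "2 * t \<le> deg E x"
proof (cases "\<exists>w\<in>V. w \<noteq> x \<and> \<not> E x w")
  case True
  then obtain w where w: "w \<in> V" "w \<noteq> x" "\<not> E x w" by blast
  define f where "f z = (if z = x then x else w)" for z
  have "f ` (V - nbs E x) = {x, w}" using w x E_irrefl by (auto simp: f_def nbs_def)
  then have c: "card (f ` (V - nbs E x)) = 2" using w by simp
  have "f a = f b" if "a \<in> V - nbs E x" "b \<in> V - nbs E x" "E a b" for a b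
    using that E_sym by (auto simp: f_def nbs_def)
  from tough_relD[OF t nbs_subset, of x f, OF this] have "t * 2 \<le> card (nbs E x)" unfolding c by simp
  then show ?thesis by (simp add: deg_def)
next
  case False
  then have "V - {x} \<subseteq> nbs E x" by (auto simp: nbs_def)
  then have "card (V - {x}) \<le> deg E x" unfolding deg_def by (intro card_mono) auto
  then show ?thesis using n x by simp
qed

section \<open>Double counting and column sums\<close>

lemma sum_nbs_swap:
  "(\<Sum>v\<in>V. \<Sum>w\<in>nbs E v. f v w) = (\<Sum>w\<in>V. \<Sum>v\<in>nbs E w. f v w)"
proof -
  have eq: "nbs E v = {w \<in> V. E v w}" "nbs E v = {w \<in> V. E w v}" for v
    using E_in E_sym by (auto simp: nbs_def)
  show ?thesis
    using sum.swap_restrict[OF finite_V finite_V, of f E] by (subst eq(1), subst eq(2)) simp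
qed

text \<open>
  Pairing the entrywise inequality \<open>A y \<ge> r y\<close> with the all-one vector avoids the
  Perron--Frobenius theorem.
\<close>

lemma column_sum_bound:
  fixes y :: "'a \<Rightarrow> real"
  assumes y: "\<And>v. v \<in> V \<Longrightarrow> 0 \<le> y v" "\<exists>v\<in>V. y v \<noteq> 0"
    and sup: "\<And>v. v \<in> V \<Longrightarrow> r * y v \<le> (\<Sum>w\<in>nbs E v. y w)"
    and a: "a \<le> r"
    and C: "\<And>v. v \<in> V \<Longrightarrow> (\<Sum>w\<in>nbs E v. real (deg E w)) - a * deg E v \<le> C"
  shows "r\<^sup>2 - a * r \<le> C"
proof -
  \<comment> \<open>With \<open>A\<close> the adjacency matrix, these are the coordinate sums of
    \<open>y\<close>, \<open>A y\<close> and \<open>A^2 y\<close>. The aim is the chain \<open>(r -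
    a) r \<alpha> \<le> (r - a) \<beta> \<le> \<gamma> - a \<beta> \<le> C \<alpha>\<close>.\<close>
  define \<alpha> where "\<alpha> = (\<Sum>v\<in>V. y v)"
  define \<beta> where "\<beta> = (\<Sum>v\<in>V. \<Sum>w\<in>nbs E v. y w)"
  define \<gamma> where "\<gamma> = (\<Sum>v\<in>V. deg E v * (\<Sum>w\<in>nbs E v. y w))"
  have pos: "\<alpha> > 0"
  proof -
    obtain v where "v \<in> V" "y v \<noteq> 0" using y(2) by blast
    then show ?thesis unfolding \<alpha>_def using y(1) finite_V
      by (metis less_eq_real_def sum_nonneg sum_nonneg_eq_0_iff)
  qed
  have b: "r * \<alpha> \<le> \<beta>" unfolding \<alpha>_def \<beta>_def sum_distrib_left using sup by (intro sum_mono)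
  have b': "\<beta> = (\<Sum>w\<in>V. deg E w * y w)"
    unfolding \<beta>_def by (subst sum_nbs_swap) (simp add: deg_def)
  have "r * \<beta> = (\<Sum>w\<in>V. deg E w * (r * y w))"
    unfolding b' by (simp add: sum_distrib_left mult.left_commute)
  also have "\<dots> \<le> \<gamma>"
    unfolding \<gamma>_def using sup by (intro sum_mono mult_left_mono) auto
  finally have \<gamma>: "r * \<beta> \<le> \<gamma>" .
  have "\<gamma> = (\<Sum>v\<in>V. \<Sum>w\<in>nbs E v. deg E v * y w)"
    unfolding \<gamma>_def by (simp add: sum_distrib_left)
  then have "\<gamma> = (\<Sum>w\<in>V. (\<Sum>v\<in>nbs E w. real (deg E v)) * y w)"
    by (subst (asm) sum_nbs_swap) (simp add: sum_distrib_right)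
  then have "\<gamma> - a * \<beta> = (\<Sum>w\<in>V. (\<Sum>v\<in>nbs E w. real (deg E v)) * y w) - (\<Sum>w\<in>V. a * deg E w * y w)"
    unfolding b' by (simp add: sum_distrib_left mult.assoc)
  also have "\<dots> = (\<Sum>w\<in>V. ((\<Sum>v\<in>nbs E w. real (deg E v)) - a * deg E w) * y w)"
    by (simp add: sum_subtractf left_diff_distrib)
  also have "\<dots> \<le> (\<Sum>w\<in>V. C * y w)"
    using C y(1) by (intro sum_mono mult_right_mono)
  also have "\<dots> = C * \<alpha>" by (simp add: \<alpha>_def sum_distrib_left)
  finally have "(r - a) * \<beta> \<le> C * \<alpha>" using \<gamma> by (simp add: algebra_simps)
  moreover have "(r - a) * (r * \<alpha>) \<le> (r - a) * \<beta>" using a b by (intro mult_left_mono) auto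
  ultimately have "(r\<^sup>2 - a * r) * \<alpha> \<le> C * \<alpha>" by (simp add: algebra_simps power2_eq_square)
  then show ?thesis using pos by simp
qed

text \<open>Vertices other than \<open>v\<close> and its neighbours have degree at least
  \<open>d\<close>, which caps the degree sum over \<open>nbs E v\<close>. The coefficient
  \<open>d - 1\<close> makes the terms in \<open>deg E v\<close> cancel.\<close>

lemma min_deg_column_bound:
  assumes d: "\<And>v. v \<in> V \<Longrightarrow> d \<le> deg E v" and v: "v \<in> V"
  shows "(\<Sum>w\<in>nbs E v. real (deg E w)) - (real d - 1) * deg E v
     \<le> real (\<Sum>w\<in>V. deg E w) - d * (real (card V) - 1)"
proof -
  define R where "R = V - nbs E v - {v}"
  have vn: "v \<notin> nbs E v" using E_irrefl by (auto simp: nbs_def)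
  have V: "V = nbs E v \<union> insert v R" "nbs E v \<inter> insert v R = {}" "v \<notin> R" "finite R"
    using nbs_subset[of v] v vn finite_V by (auto simp: R_def)
  have cV: "card V = deg E v + (1 + card R)"
    unfolding deg_def using V(2-4) by (subst V(1), subst card_Un_disjoint) auto
  have "(\<Sum>w\<in>V. real (deg E w)) = (\<Sum>w\<in>nbs E v. real (deg E w)) + (deg E v + (\<Sum>w\<in>R. real (deg E w)))"
    using V(2-4) by (subst V(1), subst sum.union_disjoint) auto
  moreover have "(\<Sum>w\<in>R. real d) \<le> (\<Sum>w\<in>R. real (deg E w))" using d V(1) by (intro sum_mono) auto
  ultimately show ?thesis using cV by (simp add: algebra_simps)
qed

text \<open>A neighbour \<open>w\<close> contributes \<open>deg E w - (i - 1)\<close>, at most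
  \<open>i + 1\<close> in \<open>Y\<close> and at most 1 outside. A vertex of \<open>Y\<close> has
  at most \<open>i - 1\<close> and \<open>i + 1\<close> neighbours of these kinds; any other vertex
  has at most \<open>i\<close> in all.\<close>

lemma small_cover_column_bound:
  assumes Y: "Y \<subseteq> V" "card Y = i" "card V = 2 * i + 1"
    and X: "\<And>x. x \<in> V - Y \<Longrightarrow> deg E x \<le> i" and v: "v \<in> V" 
  shows "(\<Sum>w\<in>nbs E v. real (deg E w)) - (real i - 1) * deg E v \<le> i * (i + 1)"
proof -
  let ?A = "nbs E v \<inter> Y" and ?B = "nbs E v - Y"
  have finY: "finite Y" using Y(1) finite_V finite_subset by blast
  have cA: "card ?A + card ?B = deg E v"
    unfolding deg_def by (metis Int_Diff_Un Int_Diff_disjoint card_Un_disjoint finite_Diff finite_Int finite_nbs)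
  have "(\<Sum>w\<in>nbs E v. real (deg E w)) = (\<Sum>w\<in>?A. real (deg E w)) + (\<Sum>w\<in>?B. real (deg E w))"
    by (metis Int_Diff_Un Int_Diff_disjoint sum.union_disjoint finite_Diff finite_Int finite_nbs)
  also have "(\<Sum>w\<in>?A. real (deg E w)) \<le> (\<Sum>w\<in>?A. real (2 * i))"
    using deg_le Y nbs_subset by (intro sum_mono) fastforce
  also have "(\<Sum>w\<in>?B. real (deg E w)) \<le> (\<Sum>w\<in>?B. real i)"
    using X nbs_subset by (intro sum_mono) fastforce
  finally have "(\<Sum>w\<in>nbs E v. real (deg E w)) - (real i - 1) * deg E v
      \<le> card ?A * (2 * i) + card ?B * i - (real i - 1) * (card ?A + card ?B)"
    using cA by simp
  also have "\<dots> = (i + 1) * card ?A + card ?B" by (simp add: algebra_simps)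
  also have "\<dots> \<le> i * (i + 1)"
  proof (cases "v \<in> Y")
    case True
    have "?A \<subseteq> Y - {v}" using E_irrefl by (auto simp: nbs_def)
    then have "card ?A \<le> i - 1" using True finY Y(2) by (metis card_Diff_singleton card_mono finite_Diff)
    moreover have "i > 0" using True finY Y(2) card_gt_0_iff by blast
    moreover have "?B \<subseteq> V - Y" using nbs_subset by auto
    then have "card ?B \<le> i + 1" using Y finY finite_V card_mono[of "V - Y" ?B] by (simp add: card_Diff_subset)
    ultimately have "(i + 1) * card ?A + card ?B \<le> (i + 1) * (i - 1) + (i + 1)"
      by (intro add_mono mult_le_mono) auto
    also have "\<dots> = i * (i + 1)" using \<open>i > 0\<close> by (cases i) auto
    finally show ?thesis by (metis of_nat_le_iff of_nat_add of_nat_mult of_nat_1)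
  next
    case False
    then have "card ?A + card ?B \<le> i" using X v cA by simp
    then have "(i + 1) * (card ?A + card ?B) \<le> (i + 1) * i" by (rule mult_le_mono2)
    then have "(i + 1) * card ?A + card ?B \<le> (i + 1) * i" by (simp add: algebra_simps)
    then show ?thesis by (metis of_nat_le_iff of_nat_add of_nat_mult of_nat_1 mult.commute)
  qed
  finally show ?thesis by simp
qed

lemma complete_hamiltonian:
  assumes "\<And>x y. x \<in> V \<Longrightarrow> y \<in> V \<Longrightarrow> x \<noteq> y \<Longrightarrow> E x y" "3 \<le> card V"
  shows "hamiltonian V E"
proof -
  obtain xs where xs: "distinct xs" "set xs = V" using finite_V finite_distinct_list by blast
  then have l: "3 \<le> length xs" using assms(2) distinct_card by fastforce
  have "successively E xs"
    using xs assms(1) by (force simp: successively_conv_nth nth_eq_iff_index_eq)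
  moreover have "last xs \<noteq> hd xs"
    using l xs(1) by (subst hd_conv_nth, force, subst last_conv_nth, force, subst nth_eq_iff_index_eq) auto
  then have "E (last xs) (hd xs)" using assms(1) xs l by (metis hd_in_set last_in_set list.size(3) not_numeral_le_zero)
  ultimately show ?thesis using xs l by (auto simp: hamiltonian_def cyclic_def)
qed

end

section \<open>Edge-maximal non-Hamiltonian graphs\<close>

lemma successively_not_in:
  assumes "successively R xs" "u \<notin> set xs"
    "\<And>x y. R x y \<Longrightarrow> S x y \<or> x = u \<or> y = u"
  shows "successively S xs"
  using assms by (induction xs rule: induct_list012) auto

text \<open>The Hamiltonian cycle must use the new edge; without it, a Hamiltonian path between
  \<open>u\<close> and \<open>v\<close> remains, whose end degrees are bounded.\<close>

lemma (in simple_graph) hamiltonian_add_edge: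
  assumes uv: "u \<in> V" "v \<in> V" "u \<noteq> v"
    and nh: "\<not> hamiltonian V E"
    and h: "hamiltonian V (\<lambda>x y. E x y \<or> x = u \<and> y = v \<or> x = v \<and> y = u)" (is "hamiltonian V ?E")
  shows "deg E u + deg E v \<le> card V - 1"
proof -
  interpret E': simple_graph V ?E
    using finite_V E_in E_sym E_irrefl uv by unfold_locales blast+
  obtain ws where ws: "cyclic ?E ws" "set ws = V" using h by (auto simp: hamiltonian_def)
  then obtain p where p: "p < length ws" "ws ! p = u" using uv(1) by (metis in_set_conv_nth)
  let ?xs = "rotate p ws"
  have xs: "cyclic ?E ?xs" "set ?xs = V" using ws E'.cyclic_rotate by auto
  have hd: "hd ?xs = u" using p by (subst hd_rotate_conv_nth) auto
  have "?xs \<noteq> []" using p by auto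
  then obtain zs where "?xs = u # zs" using hd by (cases ?xs) auto
  then have zs: "cyclic ?E (u # zs)" "set (u # zs) = V" using xs by auto
  have d: "distinct (u # zs)" "2 \<le> length zs" using zs(1) by (auto simp: cyclic_def)
  \<comment> \<open>The two neighbours of \<open>u\<close> on the cycle differ, so at most one of
    them is \<open>v\<close>.\<close>
  have "zs \<noteq> []" using d by auto
  moreover from this have "hd zs \<noteq> last zs"
    using d by (subst hd_conv_nth, simp, subst last_conv_nth, simp, subst nth_eq_iff_index_eq) auto
  ultimately have ne: "zs \<noteq> []" "hd zs \<noteq> last zs" .
  have sz: "successively E zs"
    using successively_not_in[of ?E zs u E] zs(1) d(1) by (auto simp: cyclic_def successively_Cons)
  have e: "?E u (hd zs)" "?E (last zs) u" using zs(1) ne by (auto simp: cyclic_def successively_Cons)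
  show ?thesis
  proof (cases "hd zs = v")
    case True
    then have "E (last zs) u" using e(2) ne uv by auto
    then have "successively E (zs @ [u])" using sz ne by (simp add: successively_append_iff)
    moreover have "distinct (zs @ [u])" "set (zs @ [u]) = V" using d zs(2) by auto
    ultimately show ?thesis
      using hamiltonian_path_deg_sum[of "zs @ [u]"] nh ne d True by (simp add: add.commute)
  next
    case False
    then have s: "successively E (u # zs)" using e(1) sz uv by (auto simp: successively_Cons)
    show ?thesis
    proof (cases "last zs = v")
      case True
      then show ?thesis
        using hamiltonian_path_deg_sum[of "u # zs"] nh ne d s zs(2) by simp
    next
      case False
      then have "cyclic E (u # zs)" using e(2) s uv d ne by (auto simp: cyclic_def)
      then show ?thesis using nh zs(2) by (auto simp: hamiltonian_def)
    qed
  qed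
qed

text \<open>Relations are taken as sets of pairs, so that an inclusion-maximal one exists by
  finiteness. Adding any missing edge to it creates a Hamiltonian cycle.\<close>

lemma (in simple_graph) maximal_nonhamiltonian:
  assumes "\<not> hamiltonian V E"
  obtains H where "simple_graph V H" "\<And>x y. E x y \<Longrightarrow> H x y" "\<not> hamiltonian V H"
    "\<And>x y. x \<in> V \<Longrightarrow> y \<in> V \<Longrightarrow> x \<noteq> y \<Longrightarrow> \<not> H x y \<Longrightarrow> deg H x + deg H y \<le> card V - 1"
proof -
  define \<R> where "\<R> = {R. R \<subseteq> V \<times> V \<and> simple_graph V (\<lambda>x y. (x, y) \<in> R) \<and>
    (\<forall>x y. E x y \<longrightarrow> (x, y) \<in> R) \<and> \<not> hamiltonian V (\<lambda>x y. (x, y) \<in> R)}"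
  have "finite \<R>" using finite_V by (intro finite_subset[of \<R> "Pow (V \<times> V)"]) (auto simp: \<R>_def)
  moreover have "{(x, y). E x y} \<in> \<R>"
    using assms simple_graph_axioms E_in by (auto simp: \<R>_def)
  ultimately obtain R where R: "R \<in> \<R>" and max: "\<And>S. S \<in> \<R> \<Longrightarrow> R \<subseteq> S \<Longrightarrow> R = S"
    using finite_has_maximal2[of \<R>] by metis
  define H where "H = (\<lambda>x y. (x, y) \<in> R)"
  interpret H: simple_graph V H using R by (simp add: \<R>_def H_def)
  have nh: "\<not> hamiltonian V H" using R by (simp add: \<R>_def H_def)
  show ?thesis
  proof
    show "simple_graph V H" ..
    show "E x y \<Longrightarrow> H x y" for x y using R by (simp add: \<R>_def H_def)
    show "\<not> hamiltonian V H" by fact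
    fix u v assume uv: "u \<in> V" "v \<in> V" "u \<noteq> v" "\<not> H u v"
    let ?S = "R \<union> {(u, v), (v, u)}"
    let ?H = "\<lambda>x y. H x y \<or> x = u \<and> y = v \<or> x = v \<and> y = u"
    have S: "(\<lambda>x y. (x, y) \<in> ?S) = ?H" by (auto simp: H_def)
    have "simple_graph V ?H"
      using finite_V H.E_in H.E_sym H.E_irrefl uv by unfold_locales blast+
    moreover have "R \<noteq> ?S" using uv by (auto simp: H_def)
    moreover have "?S \<subseteq> V \<times> V" "\<forall>x y. E x y \<longrightarrow> (x, y) \<in> ?S" using R uv by (auto simp: \<R>_def)
    ultimately have "hamiltonian V ?H"
      using max[of ?S] unfolding \<R>_def mem_Collect_eq S by blast
    with nh uv show "deg H u + deg H v \<le> card V - 1"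
      by (intro H.hamiltonian_add_edge)
  qed
qed

section \<open>Hamiltonicity\<close>

text \<open>
  \<open>u\<close>, \<open>v\<close> is a nonadjacent pair of largest degree sum, \<open>i = deg u\<close> and \<open>k = n - 1 - deg v\<close>. The slack
  of a vertex is the distance of its degree from the bound that the choice of \<open>u\<close>, \<open>v\<close> gives.
  If the total slack is below \<open>k\<close>, then all \<open>k\<close> nonneighbours of \<open>v\<close> have the same
  neighbourhood as \<open>u\<close>, which is too small a separator.
\<close>

lemma (in simple_graph) ore_tough_structure:
  assumes ore: "\<And>x y. x \<in> V \<Longrightarrow> y \<in> V \<Longrightarrow> x \<noteq> y \<Longrightarrow> \<not> E x y \<Longrightarrow> deg E x + deg E y \<le> card V - 1"
    and t: "tough_rel V E t" "0 < t"
    and incomplete: "\<exists>x\<in>V. \<exists>y\<in>V. x \<noteq> y \<and> \<not> E x y"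
  obtains u i k where "u \<in> V" "i = deg E u" "i \<le> k" "i + k + 1 \<le> card V"
    "\<And>x. x \<in> V - nbs E u \<Longrightarrow> deg E x + k + 1 \<le> card V"
    "int (\<Sum>x\<in>V. deg E x) \<le> int (card V) * (int (card V) - 1) - int k * (2 * int (card V) - 2 * int i - int k)"
proof -
  let ?n = "card V"
  let ?M = "{(x, y). x \<in> V \<and> y \<in> V \<and> x \<noteq> y \<and> \<not> E x y}"
  let ?h = "\<lambda>q. deg E (fst q) + deg E (snd q)"
  have "finite ?M" using finite_V by (intro finite_subset[of ?M "V \<times> V"]) auto
  moreover have "?M \<noteq> {}" using incomplete by auto
  ultimately have Mx: "finite (?h ` ?M)" "?h ` ?M \<noteq> {}" by auto
  from Max_in[OF Mx] obtain p where p: "p \<in> ?M" "Max (?h ` ?M) = ?h p" by blast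
  then have pmax: "?h q \<le> ?h p" if "q \<in> ?M" for q
    using Max_ge[OF Mx(1) imageI[OF that]] by simp
  obtain u v where uv: "u \<in> V" "v \<in> V" "u \<noteq> v" "\<not> E u v" "deg E u \<le> deg E v"
    and max: "\<And>x y. x \<in> V \<Longrightarrow> y \<in> V \<Longrightarrow> x \<noteq> y \<Longrightarrow> \<not> E x y \<Longrightarrow> deg E x + deg E y \<le> deg E u + deg E v"
  proof -
    obtain a b where ab: "p = (a, b)" by fastforce
    have p': "a \<in> V" "b \<in> V" "a \<noteq> b" "\<not> E a b" "\<not> E b a" using p(1) ab E_commute by auto
    have max: "deg E x + deg E y \<le> deg E a + deg E b" if "x \<in> V" "y \<in> V" "x \<noteq> y" "\<not> E x y" for x y
      using pmax[of "(x, y)"] that unfolding ab by simp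
    show ?thesis
    proof (cases "deg E a \<le> deg E b")
      case True
      then show ?thesis using that[of a b] p' max by blast
    next
      case False
      then show ?thesis using that[of b a] p' max by (simp add: add.commute)
    qed
  qed
  define i where "i = deg E u"
  define k where "k = ?n - 1 - deg E v"
  have dv: "deg E v + k + 1 = ?n" using deg_le[OF uv(2)] uv(2) finite_V card_gt_0_iff[of V] by (auto simp: k_def)
  have ik: "i \<le> k" "i + k + 1 \<le> ?n" using ore[OF uv(1-4)] dv uv(5) by (auto simp: i_def)
  \<comment> \<open>Maximality of the pair bounds degrees by \<open>i\<close> on \<open>P\<close>,
    of size \<open>k\<close>, and by \<open>n - 1 - k\<close> on \<open>Q\<close>, of size
    \<open>n - i\<close>; note that \<open>u\<close> lies in \<open>Q\<close>.\<close>
  define P where "P = V - nbs E v - {v}"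
  define Q where "Q = V - nbs E u"
  have degP: "deg E x \<le> i" if "x \<in> P" for x
    using max[of x v] that uv(2) E_sym by (auto simp: P_def i_def nbs_def)
  have degQ: "deg E x + k + 1 \<le> ?n" if "x \<in> Q" for x
  proof (cases "x = u")
    case True then show ?thesis using uv(5) dv by simp
  next
    case False then show ?thesis using max[of u x] that uv(1) dv by (auto simp: Q_def nbs_def)
  qed
  have cP: "card P = k"
  proof -
    have "v \<in> V - nbs E v" using uv(2) E_irrefl by (auto simp: nbs_def)
    then show ?thesis
      using nbs_subset[of v] dv by (simp add: P_def card_Diff_subset deg_def[symmetric])
  qed
  have cQ: "card Q = ?n - i" using nbs_subset[of u] by (simp add: Q_def card_Diff_subset deg_def i_def)
  have PV: "P \<subseteq> V" and QV: "Q \<subseteq> V" by (auto simp: P_def Q_def)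
  define n' where "n' = int ?n"
  \<comment> \<open>The degree bounds are \<open>n - 1\<close> in general, \<open>n - 1 - k\<close>
    on \<open>Q - P\<close>, and \<open>i\<close> on \<open>P \<inter> Q\<close>. On
    \<open>P - Q\<close> the bound is \<open>i + k\<close>, so the slack there is at least
    \<open>k\<close>.\<close>
  define sl where "sl x = n' - 1 - int (deg E x) - (if x \<in> Q then int k else 0)
    - (if x \<in> P then n' - 1 - int k - int i else 0)" for x
  have sl_nonneg: "0 \<le> sl x" if "x \<in> V" for x
  proof -
    have "int (deg E x) \<le> n' - 1" using deg_le[OF that] ik by (simp add: n'_def)
    then show ?thesis using degP[of x] degQ[of x] ik by (auto simp: sl_def n'_def)
  qed
  have sum_sl: "(\<Sum>x\<in>V. sl x) = n' * (n' - 1) - int (\<Sum>x\<in>V. deg E x) - (n' - int i) * int k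
      - int k * (n' - 1 - int k - int i)"
  proof -
    have "V \<inter> Q = Q" "V \<inter> P = P" using PV QV by auto
    then show ?thesis
      unfolding sl_def sum_subtractf using finite_V cP cQ ik
      by (simp add: sum.If_cases Collect_mem_eq n'_def Int_def[symmetric] of_nat_diff algebra_simps)
  qed
  have "int k \<le> (\<Sum>x\<in>V. sl x)"
  proof (rule ccontr)
    assume "\<not> int k \<le> (\<Sum>x\<in>V. sl x)"
    then have small: "(\<Sum>x\<in>V. sl x) < int k" by simp
    have sl1: "sl x < int k" if "x \<in> V" for x
    proof -
      have "sl x \<le> (\<Sum>x\<in>V. sl x)" using that sl_nonneg finite_V by (intro member_le_sum) auto
      then show ?thesis using small by simp
    qed
    have sl2: "sl x + sl y < int k" if "x \<in> V" "y \<in> V" "x \<noteq> y" for x y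
    proof -
      have "sum sl {x, y} \<le> (\<Sum>x\<in>V. sl x)" using that sl_nonneg finite_V by (intro sum_mono2) auto
      then show ?thesis using small that by simp
    qed
    have PQ: "P \<subseteq> Q"
    proof
      fix x assume x: "x \<in> P"
      show "x \<in> Q"
      proof (rule ccontr)
        assume "x \<notin> Q"
        then show False using sl1[of x] x PV degP[OF x] by (auto simp: sl_def)
      qed
    qed
    have nbsP: "nbs E x = nbs E u" if x: "x \<in> P" for x
    proof -
      have "nbs E u \<subseteq> nbs E x"
      proof
        fix y assume y: "y \<in> nbs E u"
        show "y \<in> nbs E x"
        proof (rule ccontr)
          assume ny: "y \<notin> nbs E x"
          have yV: "y \<in> V" "y \<notin> Q" "y \<notin> P" using y nbs_subset PQ by (auto simp: Q_def)
          have xy: "x \<noteq> y" "x \<in> V" "x \<in> Q" using yV x PV PQ by auto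
          \<comment> \<open>The slacks are \<open>i - deg E x\<close> and
            \<open>n - 1 - deg E y\<close>, so this bound makes their sum at least
            \<open>k\<close>.\<close>
          have "deg E x + deg E y \<le> i + deg E v"
            using max[of x y] xy yV ny by (auto simp: nbs_def i_def)
          then show False
            using sl2[of x y] xy yV x dv degP[OF x] by (simp add: sl_def n'_def)
        qed
      qed
      moreover have "card (nbs E x) \<le> card (nbs E u)" using degP[OF x] by (simp add: deg_def i_def)
      ultimately show ?thesis using card_seteq[of "nbs E x" "nbs E u"] by simp
    qed
    \<comment> \<open>Once \<open>nbs E u\<close> is deleted, every vertex of \<open>P\<close> is
      isolated and \<open>v\<close> lies elsewhere: \<open>k + 1\<close> labels against
      \<open>i \<le> k\<close> deleted vertices.\<close>
    define f where "f x = (if x \<in> P then x else v)" for x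
    have vP: "v \<notin> P" "v \<notin> nbs E u" using uv(4) by (auto simp: P_def nbs_def)
    have im: "f ` (V - nbs E u) = insert v P"
      using vP uv(2) PQ PV by (force simp: f_def Q_def)
    then have cim: "card (f ` (V - nbs E u)) = k + 1"
      using vP cP PV finite_V finite_subset[of P V] by simp
    have "f x = f y" if "x \<in> V - nbs E u" "y \<in> V - nbs E u" "E x y" for x y
    proof -
      have "x \<notin> P" using nbsP[of x] that by (auto simp: nbs_def)
      moreover have "y \<notin> P" using nbsP[of y] that E_sym by (auto simp: nbs_def)
      ultimately show ?thesis by (simp add: f_def)
    qed
    moreover have "k > 0"
    proof -
      have "u \<in> P" using uv E_sym by (auto simp: P_def nbs_def)
      then show ?thesis using cP PV finite_V finite_subset[of P V] card_gt_0_iff by blast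
    qed
    ultimately have "t * (k + 1) \<le> card (nbs E u)"
      using tough_relD[OF t(1) nbs_subset, of u f] unfolding cim by simp
    then have "t * (k + 1) \<le> i" by (simp add: deg_def i_def)
    moreover have "1 * (k + 1) \<le> t * (k + 1)" using t(2) by (intro mult_le_mono1) simp
    ultimately show False using ik by simp
  qed
  then have "int (\<Sum>x\<in>V. deg E x) \<le> int ?n * (int ?n - 1) - int k * (2 * int ?n - 2 * int i - int k)"
    unfolding sum_sl n'_def by (simp add: algebra_simps)
  moreover have "deg E x + k + 1 \<le> ?n" if "x \<in> V - nbs E u" for x
    using degQ that by (simp add: Q_def)
  ultimately show ?thesis using that[of u i k] uv(1) ik by (simp add: i_def)
qed

section \<open>Numerical estimates for the three values of \<open>t\<close>\<close>

text \<open>The left side will bound \<open>n * (n - 1)\<close> minus the degree sum from above, the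
  right side from below. For \<open>k = i\<close> the excluded cases really fail, with 82 against 80
  and 227 against 224.\<close>

lemma degree_sum_arith:
  fixes n i k t g :: int
  assumes ik: "2 * t \<le> i" "i \<le> k" "i + k + 1 \<le> n"
    and cases: "t = 1 \<and> 7 \<le> n \<and> g = 2 \<or> t = 2 \<and> 16 \<le> n \<and> g = 10 \<or> t = 3 \<and> 28 \<le> n \<and> g = 25"
    and exc: "\<not> (t = 2 \<and> n = 17 \<and> i = 8)" "\<not> (t = 3 \<and> n = 29 \<and> i = 14)"
  shows "4 * t * n - 10 * t\<^sup>2 - 2 * t - g < k * (2 * n - 2 * i - k)"
proof -
  have "0 \<le> (k - i) * (2 * n - 3 * i - k)" using ik by (intro mult_nonneg_nonneg) auto
  then have 1: "i * (2 * n - 3 * i) \<le> k * (2 * n - 2 * i - k)" by (simp add: algebra_simps)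
  \<comment> \<open>Between \<open>2 * t\<close> and \<open>(n - 1) / 2\<close> the concave
    quadratic in \<open>i\<close> is bounded below by a linear function.\<close>
  have "0 \<le> (i - 2 * t) * (n - 1 - 2 * i)" using ik by (intro mult_nonneg_nonneg) auto
  then have 2: "3 * (i * n - i - 2 * i * i - 2 * t * n + 2 * t + 4 * t * i) \<ge> 0" by (simp add: algebra_simps)
  have 3: "2 * (i * (2 * n - 3 * i)) \<ge> i * (n + 3 - 12 * t) + 6 * t * (n - 1)"
    using 2 by (simp add: algebra_simps)
  have "4 * t * n - 10 * t\<^sup>2 - 2 * t - g < i * (2 * n - 3 * i)"
  proof (cases "n + 3 - 12 * t \<ge> 0")
    case True
    then have "2 * t * (n + 3 - 12 * t) \<le> i * (n + 3 - 12 * t)" using ik by (intro mult_right_mono) auto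
    then show ?thesis using 3 cases by (auto simp: algebra_simps)
  next
    \<comment> \<open>The linear bound now decreases in \<open>i\<close>, but only finitely many
      \<open>n\<close> and \<open>i\<close> remain.\<close>
    case False
    from cases have "t = 1 \<and> n \<in> {7, 8} \<or> t = 2 \<and> n \<in> {16, 17, 18, 19, 20} \<or> t = 3 \<and> n \<in> {28, 29, 30, 31, 32}"
      using False by auto
    moreover have "i \<in> {2, 3}" if "t = 1" "n \<in> {7, 8}" using that ik by auto
    moreover have "i \<in> {4, 5, 6, 7, 8, 9}" if "t = 2" "n \<in> {16, 17, 18, 19, 20}" using that ik by auto
    moreover have "i \<in> {6, 7, 8, 9, 10, 11, 12, 13, 14, 15}" if "t = 3" "n \<in> {28, 29, 30, 31, 32}"
      using that ik by simp presburger
    ultimately consider "t = 1" "n \<in> {7, 8}" "i \<in> {2, 3}"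
      | "t = 2" "n \<in> {16, 17, 18, 19, 20}" "i \<in> {4, 5, 6, 7, 8, 9}"
      | "t = 3" "n \<in> {28, 29, 30, 31, 32}" "i \<in> {6, 7, 8, 9, 10, 11, 12, 13, 14, 15}"
      by blast
    then show ?thesis using ik cases exc by cases (auto simp: power2_eq_square)
  qed
  then show ?thesis using 1 by simp
qed

text \<open>The radicand is \<open>m^2 + 6 t^2 - 2 t\<close> with \<open>m = n - 2 t - 1\<close>, so
  its root lies slightly above \<open>m\<close>. Beyond that root \<open>r^2 - (2 t - 1) r\<close>
  increases.\<close>

lemma spectral_degree_sum_arith:
  fixes n t :: nat and r S :: real
  assumes cases: "t = 1 \<and> 7 \<le> n \<and> g = (2::int) \<or> t = 2 \<and> 16 \<le> n \<and> g = 10 \<or> t = 3 \<and> 28 \<le> n \<and> g = 25"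
    and r: "sqrt ((real n)\<^sup>2 - 4 * real t * real n - 2 * real n + 10 * (real t)\<^sup>2 + 2 * real t + 1) \<le> r"
    and S: "r\<^sup>2 - (2 * real t - 1) * r \<le> S - 2 * real t * (real n - 1)"
  shows "real n * (real n - 1) - 4 * t * n + 10 * (real t)\<^sup>2 + 2 * t + g - 1 < S"
proof -
  define N where "N = (real n)\<^sup>2 - 4 * real t * real n - 2 * real n + 10 * (real t)\<^sup>2 + 2 * real t + 1"
  define m where "m = real n - 2 * t - 1"
  \<comment> \<open>Large enough for \<open>N \<le> (m + c)^2\<close> at the least admissible
    \<open>n\<close>, yet small enough for \<open>(2 t - 1) c < 4 t^2 - 2 t - g + 1\<close>.\<close>
  define c :: real where "c = (if t = 1 then 1/2 else if t = 2 then 95/100 else 115/100)"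
  have N: "N = m\<^sup>2 + 6 * (real t)\<^sup>2 - 2 * t"
    by (simp add: N_def m_def power2_eq_square algebra_simps)
  have m: "2 * real t - 1 \<le> m" "0 \<le> m" using cases by (auto simp: m_def)
  have "m\<^sup>2 \<le> N" using cases by (auto simp: N)
  then have R1: "m \<le> sqrt N" using m by (metis real_le_rsqrt)
  have "N \<le> (m + c)\<^sup>2"
    using cases by (auto simp: N c_def m_def power2_eq_square algebra_simps)
  then have R2: "sqrt N \<le> m + c" using m by (intro real_le_lsqrt) (auto simp: c_def)
  have R0: "(sqrt N)\<^sup>2 = N" using order_trans[OF zero_le_power2 \<open>m\<^sup>2 \<le> N\<close>] by simp
  have rN: "sqrt N \<le> r" using r by (simp add: N_def)
  have "0 \<le> (r - sqrt N) * (r + sqrt N - (2 * real t - 1))"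
    using rN R1 m cases by (intro mult_nonneg_nonneg) auto
  then have "N - (2 * real t - 1) * sqrt N \<le> r\<^sup>2 - (2 * real t - 1) * r"
    using R0 by (simp add: algebra_simps power2_eq_square)
  moreover have "(2 * real t - 1) * sqrt N \<le> (2 * real t - 1) * (m + c)"
    using R2 cases by (intro mult_left_mono) auto
  ultimately have "N - (2 * real t - 1) * (m + c) + 2 * real t * (real n - 1) \<le> S" using S by linarith
  then show ?thesis using cases
    by (auto simp: N m_def c_def power2_eq_square algebra_simps)
qed

text \<open>Both conclusions, which together feed Bondy's theorem, rest on one lower bound for the
  degree sum. The vector \<open>y\<close> stands for the absolute values of an eigenvector.\<close>

lemma (in simple_graph) dense_tough_hamiltonian:
  fixes y :: "'a \<Rightarrow> real"
  assumes cases: "t = 1 \<and> 7 \<le> card V \<or> t = 2 \<and> 16 \<le> card V \<or> t = 3 \<and> 28 \<le> card V"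
    and tough: "tough_rel V E t"
    and y: "\<And>v. v \<in> V \<Longrightarrow> 0 \<le> y v" "\<exists>v\<in>V. y v \<noteq> 0"
      "\<And>v. v \<in> V \<Longrightarrow> r * y v \<le> (\<Sum>w\<in>nbs E v. y w)"
    and r: "sqrt ((real (card V))\<^sup>2 - 4 * real t * real (card V) - 2 * real (card V)
      + 10 * (real t)\<^sup>2 + 2 * real t + 1) \<le> r"
  shows "hamiltonian V E" "(card V)\<^sup>2 < 2 * (\<Sum>v\<in>V. deg E v)"
proof -
  define n where "n = card V"
  define g :: int where "g = (if t = 1 then 2 else if t = 2 then 10 else 25)"
  have cases': "t = 1 \<and> 7 \<le> n \<and> g = 2 \<or> t = 2 \<and> 16 \<le> n \<and> g = 10 \<or> t = 3 \<and> 28 \<le> n \<and> g = 25"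
    using cases by (auto simp: g_def n_def)
  have nt: "2 * t < n" "0 < t" "3 \<le> n" using cases' by auto
  let ?N = "(real n)\<^sup>2 - 4 * real t * real n - 2 * real n + 10 * (real t)\<^sup>2 + 2 * real t + 1"
  have r': "sqrt ?N \<le> r" using r by (simp add: n_def)
  have r_ge: "real n - 2 * t - 1 \<le> r"
  proof -
    have "(real n - 2 * t - 1)\<^sup>2 \<le> ?N"
      using cases' by (auto simp: power2_eq_square algebra_simps)
    then have "real n - 2 * t - 1 \<le> sqrt ?N" by (rule real_le_rsqrt)
    then show ?thesis using r' by simp
  qed
  have "2 * t \<le> deg E v" if "v \<in> V" for v
    using tough_rel_min_deg[OF tough _ that] nt by (simp add: n_def)
  from min_deg_column_bound[OF this]
  have "r\<^sup>2 - (2 * real t - 1) * r \<le> real (\<Sum>v\<in>V. deg E v) - 2 * real t * (real n - 1)"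
    using column_sum_bound[OF y, of "2 * real t - 1"] r_ge cases' by (auto simp: n_def)
  from spectral_degree_sum_arith[OF cases' r' this]
  have "real_of_int (int n * (int n - 1) - 4 * int t * int n + 10 * (int t)\<^sup>2 + 2 * int t + g - 1)
      < real_of_int (int (\<Sum>v\<in>V. deg E v))" by simp
  \<comment> \<open>Integrality absorbs the \<open>- 1\<close>.\<close>
  then have S: "int n * (int n - 1) - 4 * int t * int n + 10 * (int t)\<^sup>2 + 2 * int t + g
      \<le> int (\<Sum>v\<in>V. deg E v)" by linarith
  show "(card V)\<^sup>2 < 2 * (\<Sum>v\<in>V. deg E v)"
  proof -
    have "int n * int n < 2 * (int n * (int n - 1) - 4 * int t * int n + 10 * (int t)\<^sup>2 + 2 * int t + g)"
    proof -
      \<comment> \<open>For \<open>t\<close> = 1, 2, 3 the difference of the two sides is the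
        respective product or square plus 7, 27, 73.\<close>
      have "0 \<le> (int n - 7) * (int n - 3)" if "7 \<le> n" using that by (intro mult_nonneg_nonneg) auto
      moreover have "0 \<le> (int n - 9)\<^sup>2" "0 \<le> (int n - 13)\<^sup>2" by auto
      ultimately show ?thesis using cases' by (auto simp: power2_eq_square algebra_simps)
    qed
    then have "int (n\<^sup>2) < int (2 * (\<Sum>v\<in>V. deg E v))" using S by (simp add: power2_eq_square)
    then show ?thesis unfolding n_def by (simp only: of_nat_less_iff)
  qed
  show "hamiltonian V E"
  proof (rule ccontr)
    assume "\<not> hamiltonian V E"
    then obtain H where H: "simple_graph V H" and sup: "\<And>x y. E x y \<Longrightarrow> H x y"
      and nh: "\<not> hamiltonian V H"
      and ore: "\<And>x y. x \<in> V \<Longrightarrow> y \<in> V \<Longrightarrow> x \<noteq> y \<Longrightarrow> \<not> H x y \<Longrightarrow> deg H x + deg H y \<le> card V - 1"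
      using maximal_nonhamiltonian by blast
    interpret H: simple_graph V H by fact
    have tH: "tough_rel V H t" using tough_rel_mono[OF tough] sup by blast
    have "\<exists>x\<in>V. \<exists>y\<in>V. x \<noteq> y \<and> \<not> H x y"
      using H.complete_hamiltonian nh nt by (auto simp: n_def)
    then obtain u i k where u: "u \<in> V" "i = deg H u" and ik: "i \<le> k" "i + k + 1 \<le> n"
      and low: "\<And>x. x \<in> V - nbs H u \<Longrightarrow> deg H x + k + 1 \<le> n"
      and SH: "int (\<Sum>x\<in>V. deg H x) \<le> int n * (int n - 1) - int k * (2 * int n - 2 * int i - int k)"
      using H.ore_tough_structure[OF ore tH nt(2)] unfolding n_def by blast
    have i2: "2 * t \<le> i" using H.tough_rel_min_deg[OF tH] nt u by (simp add: n_def)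
    have sub: "nbs E v \<subseteq> nbs H v" for v using sup by (auto simp: nbs_def)
    have "(\<Sum>x\<in>V. deg E x) \<le> (\<Sum>x\<in>V. deg H x)"
      unfolding deg_def using sub by (intro sum_mono card_mono) auto
    then have S': "int (\<Sum>x\<in>V. deg E x) \<le> int (\<Sum>x\<in>V. deg H x)" by (simp only: of_nat_le_iff)
    consider "t = 2 \<and> n = 17 \<and> i = 8 \<or> t = 3 \<and> n = 29 \<and> i = 14"
      | "\<not> (t = 2 \<and> n = 17 \<and> i = 8)" "\<not> (t = 3 \<and> n = 29 \<and> i = 14)" by blast
    then show False
    proof cases
      case 1
      \<comment> \<open>Outside the \<open>i\<close> vertices of \<open>nbs H u\<close>, all degrees
        in \<open>H\<close> are at most \<open>i\<close>, so the column bound applies to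
        \<open>H\<close>.\<close>
      then have ni: "n = 2 * i + 1" "k = i" using ik by auto
      have yH: "r * y v \<le> (\<Sum>w\<in>nbs H v. y w)" if "v \<in> V" for v
      proof -
        have "(\<Sum>w\<in>nbs E v. y w) \<le> (\<Sum>w\<in>nbs H v. y w)"
          using sub y(1) H.nbs_subset[of v] by (intro sum_mono2) auto
        then show ?thesis using y(3)[OF that] by simp
      qed
      have col: "(\<Sum>w\<in>nbs H v. real (deg H w)) - (real i - 1) * deg H v \<le> i * (i + 1)"
        if "v \<in> V" for v
      proof (rule H.small_cover_column_bound[OF H.nbs_subset _ _ _ that])
        show "card (nbs H u) = i" using u by (simp add: deg_def)
        show "card V = 2 * i + 1" using ni by (simp add: n_def)
        show "deg H x \<le> i" if "x \<in> V - nbs H u" for x using low[OF that] ni by simp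
      qed
      have "real i - 1 \<le> r" using r_ge 1 by auto
      from H.column_sum_bound[OF y(1,2) yH this col]
      have *: "r * (r - (real i - 1)) \<le> i * (i + 1)" by (simp add: power2_eq_square algebra_simps)
      show False
      proof (cases "t = 2")
        case True
        \<comment> \<open>The radicand is 164, and \<open>12.8 * 5.8 = 74.24\<close> exceeds
          \<open>8 * 9\<close>.\<close>
        then have "128 / 10 \<le> r" using r' 1 real_le_rsqrt[of "128/10" 164] by (auto simp: power2_eq_square)
        then have "128/10 * (58/10) \<le> r * (r - 7)" by (intro mult_mono) auto
        then show False using * 1 True by simp
      next
        case False
        \<comment> \<open>The radicand is 532, and \<open>23 * 10\<close> exceeds
          \<open>14 * 15\<close>.\<close>
        then have "23 \<le> r" using r' 1 real_le_rsqrt[of 23 532] by (auto simp: power2_eq_square)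
        then have "23 * 10 \<le> r * (r - 13)" by (intro mult_mono) auto
        then show False using * 1 False by simp
      qed
    next
      case 2
      have "4 * int t * int n - 10 * (int t)\<^sup>2 - 2 * int t - g < int k * (2 * int n - 2 * int i - int k)"
        using ik i2 cases' 2 by (intro degree_sum_arith) auto
      then show False using S S' SH by linarith
    qed
  qed
qed

section \<open>Spectral radius and components\<close>

text \<open>A complex eigenvalue exists, and it is real because the Hermitian form \<open>q\<close>
  is. The real and imaginary parts of the eigenvector satisfy the same equation, and one of them is
  nonzero.\<close>

lemma spectrum_symmetric_nonempty:
  fixes A :: "real mat"
  assumes A: "A \<in> carrier_mat n n" "0 < n"
    and sym: "\<And>i j. i < n \<Longrightarrow> j < n \<Longrightarrow> A $$ (i, j) = A $$ (j, i)"
  shows "spectrum A \<noteq> {}"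
proof -
  let ?B = "map_mat complex_of_real A"
  obtain k where "eigenvalue ?B k"
    using spectrum_non_empty[of ?B n] A by (auto simp: spectrum_def)
  then obtain x where x: "x \<in> carrier_vec n" "x \<noteq> 0\<^sub>v n" "?B *\<^sub>v x = k \<cdot>\<^sub>v x"
    using A by (auto simp: eigenvalue_def eigenvector_def)
  have ev: "(\<Sum>j<n. of_real (A $$ (i, j)) * x $ j) = k * x $ i" if "i < n" for i
  proof -
    have "(?B *\<^sub>v x) $ i = (\<Sum>j<n. of_real (A $$ (i, j)) * x $ j)"
      using that A x(1) by (auto simp: scalar_prod_def lessThan_atLeast0 intro!: sum.cong)
    then show ?thesis using x that by simp
  qed
  define s where "s = (\<Sum>i<n. (cmod (x $ i))\<^sup>2)"
  define q where "q = (\<Sum>i<n. \<Sum>j<n. of_real (A $$ (i, j)) * (cnj (x $ i) * x $ j))"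
  have "q = (\<Sum>i<n. cnj (x $ i) * (k * x $ i))"
    unfolding q_def by (intro sum.cong refl) (simp add: ev[symmetric] sum_distrib_left mult_ac)
  also have "\<dots> = k * of_real s"
    unfolding s_def of_real_sum sum_distrib_left
    by (intro sum.cong refl) (simp add: complex_norm_square mult_ac del: of_real_power)
  finally have q: "q = k * of_real s" .
  have "cnj q = (\<Sum>j<n. \<Sum>i<n. of_real (A $$ (i, j)) * (x $ i * cnj (x $ j)))"
    unfolding q_def by (subst sum.swap) simp
  also have "\<dots> = q"
    unfolding q_def using sym by (intro sum.cong refl) (simp add: mult_ac)
  finally have "cnj q = q" .
  moreover have "s > 0"
  proof -
    obtain i where "i < n" "x $ i \<noteq> 0" using x(1,2) by (auto simp: vec_eq_iff)
    then show ?thesis unfolding s_def by (intro sum_pos2[of _ i]) auto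
  qed
  ultimately have "cnj k = k" unfolding q by simp
  then have k: "k = of_real (Re k)" by (simp add: complex_eq_iff)
  have re: "(\<Sum>j<n. A $$ (i, j) * Re (x $ j)) = Re k * Re (x $ i)" if "i < n" for i
    using arg_cong[OF ev[OF that], of Re] by (subst (asm) k) simp
  have im: "(\<Sum>j<n. A $$ (i, j) * Im (x $ j)) = Re k * Im (x $ i)" if "i < n" for i
    using arg_cong[OF ev[OF that], of Im] by (subst (asm) k) simp
  have ev_real: "eigenvalue A (Re k)"
    if h: "\<And>i. i < n \<Longrightarrow> (\<Sum>j<n. A $$ (i, j) * h j) = Re k * h i" "\<exists>i<n. h i \<noteq> 0" for h
  proof -
    have "A *\<^sub>v vec n h = Re k \<cdot>\<^sub>v vec n h"
      using A h(1) by (intro eq_vecI) (auto simp: scalar_prod_def lessThan_atLeast0 intro!: sum.cong)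
    moreover have "vec n h \<noteq> 0\<^sub>v n" using h(2) by (auto simp: vec_eq_iff)
    ultimately show ?thesis using A by (auto simp: eigenvalue_def eigenvector_def intro!: exI[of _ "vec n h"])
  qed
  obtain i where "i < n" "x $ i \<noteq> 0" using x(1,2) by (auto simp: vec_eq_iff)
  then have "Re (x $ i) \<noteq> 0 \<or> Im (x $ i) \<noteq> 0" by (auto simp: complex_eq_iff)
  then have "eigenvalue A (Re k)"
    using ev_real[OF re] ev_real[OF im] \<open>i < n\<close> by blast
  then show ?thesis by (auto simp: spectrum_def)
qed

text \<open>\<open>Max\<close> is known to be attained only on a finite nonempty set; symmetry of
  the matrix supplies nonemptiness.\<close>

lemma (in graph) spectral_radius_eigenvector:
  assumes "verts G \<noteq> {}"
  obtains f where "\<exists>v\<in>verts G. f v \<noteq> 0"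
    "\<forall>v\<in>verts G. (\<Sum>w\<in>verts G. if v \<rightarrow>\<^bsub>G\<^esub> w then f w else 0) = graph_spectral_radius G * f v"
proof -
  define vs where "vs = (SOME vs. vertex_labelling G vs)"
  have "\<exists>vs. vertex_labelling G vs"
    using finite_distinct_list[OF finite_verts] by (auto simp: vertex_labelling_def)
  then have vs: "vertex_labelling G vs" unfolding vs_def by (rule someI_ex)
  have A: "adj_matrix G vs \<in> carrier_mat (length vs) (length vs)" by (simp add: adj_matrix_def)
  have "0 < length vs" using vs assms by (auto simp: vertex_labelling_def)
  moreover have "adj_matrix G vs $$ (i, j) = adj_matrix G vs $$ (j, i)"
    if "i < length vs" "j < length vs" for i j
    using that graph_symmetric by (auto simp: adj_matrix_def)
  ultimately have "spectrum (adj_matrix G vs) \<noteq> {}"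
    using spectrum_symmetric_nonempty[OF A] by blast
  then have "graph_spectral_radius G \<in> spectrum (adj_matrix G vs)"
    unfolding graph_spectral_radius_def vs_def[symmetric]
    using card_finite_spectrum(1)[OF A] by (intro Max_in)
  then show ?thesis
    using eigenvalue_adj_matrix_iff[OF vs] that by (auto simp: spectrum_def)
qed

text \<open>The labelling is constant on each component, so sending a component to its label reaches
  all labels.\<close>

lemma (in graph) card_labels_le_num_components:
  assumes f: "\<And>x y. x \<in> verts G - S \<Longrightarrow> y \<in> verts G - S \<Longrightarrow> x \<rightarrow>\<^bsub>G\<^esub> y \<Longrightarrow> f x = f y"
  shows "card (f ` (verts G - S)) \<le> num_components (delete_verts G S)"
proof -
  let ?W = "verts G - S"
  let ?D = "delete_verts G S"
  interpret D: wf_digraph ?D unfolding delete_verts_def by (rule wellformed_induce_subgraph)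
  have vD: "verts ?D = ?W" by (simp add: delete_verts_def)
  have adj: "f x = f y" if "x \<rightarrow>\<^bsub>?D\<^esub> y" for x y
  proof -
    have "x \<rightarrow>\<^bsub>G\<^esub> y" using that unfolding delete_verts_def by (rule dominates_induce_subgraphD)
    moreover have "x \<in> ?W" "y \<in> ?W" using that vD D.wellformed by (auto elim!: reachableE)
    ultimately show ?thesis using f by blast
  qed
  have reach: "f x = f y" if "x \<rightarrow>\<^sup>*\<^bsub>?D\<^esub> y" for x y
    using that unfolding reachable_def by (induction rule: rtrancl_on_induct) (auto dest: adj)
  have im: "f ` D.scc_of x = {f x}" if "x \<in> ?W" for x
    using D.in_scc_of_self[of x] that reach vD by (auto simp: D.scc_of_def)
  have "f ` ?W = (\<lambda>C. the_elem (f ` C)) ` (D.scc_of ` ?W)"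
    unfolding image_image using im by (intro image_cong) auto
  then have "card (f ` ?W) \<le> card (D.scc_of ` ?W)"
    using finite_verts by (metis card_image_le finite_Diff finite_imageI)
  also have "\<dots> = num_components ?D"
    using D.sccs_verts_conv_scc_of D.card_sccs_verts vD by (simp add: num_components_def)
  finally show ?thesis .
qed

section \<open>Cycles as arc walks\<close>

lemma (in wf_digraph) successively_imp_awalk:
  assumes "successively (\<lambda>x y. x \<rightarrow>\<^bsub>G\<^esub> y) (u # xs)" "u \<in> verts G"
  shows "\<exists>p. awalk u p (last (u # xs)) \<and> awalk_verts u p = u # xs \<and> length p = length xs"
  using assms
proof (induction xs arbitrary: u)
  case Nil
  then show ?case by (intro exI[of _ "[]"]) (simp add: awalk_Nil_iff)
next
  case (Cons x xs)
  then have e: "u \<rightarrow>\<^bsub>G\<^esub> x" "successively (\<lambda>x y. x \<rightarrow>\<^bsub>G\<^esub> y) (x # xs)" by auto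
  then obtain e where e': "e \<in> arcs G" "tail G e = u" "head G e = x" by auto
  then have "x \<in> verts G" by auto
  from Cons.IH[OF e(2) this] obtain p where
    "awalk x p (last (x # xs))" "awalk_verts x p = x # xs" "length p = length xs" by blast
  then show ?case using e' by (intro exI[of _ "e # p"]) (auto simp: awalk_Cons_iff)
qed

lemma (in wf_digraph) successively_imp_cycle:
  assumes "successively (\<lambda>x y. x \<rightarrow>\<^bsub>G\<^esub> y) xs" "last xs \<rightarrow>\<^bsub>G\<^esub> hd xs" "distinct xs" "xs \<noteq> []"
  shows "\<exists>p. cycle p \<and> length p = length xs"
proof -
  obtain u zs where xs: "xs = u # zs" using assms(4) by (cases xs) auto
  \<comment> \<open>Repeating \<open>u\<close> closes the walk, which then has as many arcs as
    \<open>xs\<close> has vertices.\<close>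
  have "successively (\<lambda>x y. x \<rightarrow>\<^bsub>G\<^esub> y) (u # (zs @ [u]))"
    using assms(1,2) xs successively_append_iff[of _ "u # zs" "[u]"] by simp
  moreover have "u \<in> verts G" using assms(2) xs by (auto elim!: reachableE)
  ultimately obtain p where "awalk u p (last (u # (zs @ [u])))" "awalk_verts u p = u # (zs @ [u])"
    "length p = length (zs @ [u])"
    using successively_imp_awalk by blast
  then show ?thesis
    using assms(3) xs by (intro exI[of _ p]) (auto simp: cycle_def)
qed

theorem theorem2p2:
  fixes G :: "('a, 'b) pre_digraph" and t n m :: nat
  assumes "graph G" and "connected G"
    and "card (verts G) = n" and "card (edges G) = m"
    and "t \<in> {1, 2, 3}"
    and "tough (real t) G"
    and "graph_spectral_radius G
           \<ge> sqrt ((real n)\<^sup>2 - 4 * real t * real n - 2 * real n + 10 * (real t)\<^sup>2 + 2 * real t + 1)"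
    and "t = 1 \<and> n \<ge> 7 \<or> t = 2 \<and> n \<ge> 16 \<or> t = 3 \<and> n \<ge> 28"
  shows "pancyclic G \<or> bipartite G"
proof -
  interpret graph G by fact
  let ?E = "\<lambda>x y. x \<rightarrow>\<^bsub>G\<^esub> y"
  let ?r = "graph_spectral_radius G"
  interpret E: simple_graph "verts G" ?E
    using adj_not_same graph_symmetric adj_in_verts by unfold_locales auto
  have t: "tough_rel (verts G) ?E t"
    unfolding tough_rel_def
  proof (intro allI impI)
    fix S and f :: "'a \<Rightarrow> 'a"
    assume S: "S \<subseteq> verts G"
      and f: "\<forall>x\<in>verts G - S. \<forall>y\<in>verts G - S. x \<rightarrow>\<^bsub>G\<^esub> y \<longrightarrow> f x = f y"
      and c: "2 \<le> card (f ` (verts G - S))"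
    have le: "card (f ` (verts G - S)) \<le> num_components (delete_verts G S)"
      using f by (intro card_labels_le_num_components) blast
    \<comment> \<open>Two labels force two components.\<close>
    then have "vertex_cutset G S" using S c by (simp add: vertex_cutset_def)
    then have "real (t * num_components (delete_verts G S)) \<le> real (card S)"
      using assms(6) by (simp add: tough_def)
    then have "t * num_components (delete_verts G S) \<le> card S" by (simp only: of_nat_le_iff)
    then show "t * card (f ` (verts G - S)) \<le> card S" using le by (meson le_trans mult_le_mono2)
  qed
  have "verts G \<noteq> {}" using assms(3,8) by auto
  then obtain f where f: "\<exists>v\<in>verts G. f v \<noteq> 0"
    "\<forall>v\<in>verts G. (\<Sum>w\<in>verts G. if v \<rightarrow>\<^bsub>G\<^esub> w then f w else 0) = ?r * f v"
    by (rule spectral_radius_eigenvector)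
  \<comment> \<open>The triangle inequality in the eigenvalue equation gives this for an eigenvector
    of any signs.\<close>
  have y: "?r * \<bar>f v\<bar> \<le> (\<Sum>w\<in>nbs ?E v. \<bar>f w\<bar>)" if "v \<in> verts G" for v
  proof -
    have "(\<Sum>w\<in>verts G. if v \<rightarrow>\<^bsub>G\<^esub> w then f w else 0) = (\<Sum>w\<in>nbs ?E v. f w)"
      using E.nbs_subset[of v] by (intro sum.mono_neutral_cong_right) (auto simp: nbs_def)
    then have "?r * f v = (\<Sum>w\<in>nbs ?E v. f w)" using f(2) that by simp
    moreover have "?r * \<bar>f v\<bar> \<le> \<bar>?r * f v\<bar>" by (simp add: abs_mult mult_right_mono)
    ultimately show ?thesis using sum_abs[of f "nbs ?E v"] by linarith
  qed
  have ham: "hamiltonian (verts G) ?E"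
    and dense: "(card (verts G))\<^sup>2 < 2 * (\<Sum>v\<in>verts G. deg ?E v)"
    using E.dense_tough_hamiltonian[OF _ t _ _ y] f(1) assms(3,7,8) by auto
  have "\<exists>p. cycle p \<and> length p = l" if l: "3 \<le> l" "l \<le> card (verts G)" for l
  proof -
    obtain xs where xs: "cyclic ?E xs" "length xs = l" using E.bondy[OF ham dense l] by blast
    then have "xs \<noteq> []" using l by auto
    then show ?thesis
      using successively_imp_cycle[of xs] xs unfolding cyclic_def by blast
  qed
  then show ?thesis by (simp add: pancyclic_def)
qed

end
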